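(* Let $p$ be a propositional variable. There is no formula $\varphi\in\mathsf L_{\mathsf U}$ such that $\Box p\leftrightarrow\varphi$ is valid over the class of finite here-and-there models.
   Context: $\mathsf L_{\mathsf U}$: formulas built from variables and $\bot$ using $\wedge,\vee,\to,\bigcirc,\mathsf U$. A model is $(W,\preccurlyeq,S,V)$ with $\preccurlyeq$ a partial order on nonempty $W$, $S\colon W\to W$ forward confluent ($w\preccurlyeq v\Rightarrow S(w)\preccurlyeq S(v)$), and monotone $V\colon W\to\mathcal P(\mathbb P)$. Satisfaction: atoms by $V$; $\bot$ false; $\wedge,\vee$ classical; $w\models\bigcirc\varphi$ iff $S(w)\models\varphi$; $w\models\varphi\to\psi$ iff every $v\succcurlyeq w$ with $v\models\varphi$ has $v\models\psi$; $w\models\Box\varphi$ iff $S^k(w)\models\varphi$ for all $k\ge0$; $w\models\varphi\,\mathsf U\,\psi$ iff some $k\ge0$ has $S^k(w)\models\psi$ and $S^i(w)\models\varphi$ for all $i<k$. A here-and-there model is a model with $W=T\times\{0,1\}$ for some set $T$ such that there is $f\colon T\to T$ with $(t,i)\preccurlyeq(s,j)$ iff $t=s$ and $i\le j$, and $S(t,i)=(f(t),i)$. It is finite if $W$ is finite. *)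

theory Defs
  imports Main
begin

text \<open>
  The equivalence to be refuted mixes \<open>\<box>\<close> with formulas of the language without \<open>\<box>\<close>, so the
  datatype contains both \<open>\<box>\<close> and \<open>U\<close>, and the \<open>\<box>\<close>-free language is carved out as \<open>L_U\<close> below.
\<close>

datatype 'p fm =
    Var 'p
  | Bot
  | And "'p fm" "'p fm"
  | Or "'p fm" "'p fm"
  | Imp "'p fm" "'p fm"
  | Next "'p fm"
  | Box "'p fm"
  | Until "'p fm" "'p fm"

definition Iff :: "'p fm \<Rightarrow> 'p fm \<Rightarrow> 'p fm" where
  "Iff \<phi> \<psi> = And (Imp \<phi> \<psi>) (Imp \<psi> \<phi>)"

inductive_set L_U :: "'p fm set" where
  "Var p \<in> L_U"
| "Bot \<in> L_U"
| "\<lbrakk>\<phi> \<in> L_U; \<psi> \<in> L_U\<rbrakk> \<Longrightarrow> And \<phi> \<psi> \<in> L_U"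
| "\<lbrakk>\<phi> \<in> L_U; \<psi> \<in> L_U\<rbrakk> \<Longrightarrow> Or \<phi> \<psi> \<in> L_U"
| "\<lbrakk>\<phi> \<in> L_U; \<psi> \<in> L_U\<rbrakk> \<Longrightarrow> Imp \<phi> \<psi> \<in> L_U"
| "\<phi> \<in> L_U \<Longrightarrow> Next \<phi> \<in> L_U"
| "\<lbrakk>\<phi> \<in> L_U; \<psi> \<in> L_U\<rbrakk> \<Longrightarrow> Until \<phi> \<psi> \<in> L_U"

text \<open>
  The set of worlds is an explicit carrier; the values of the other three components outside of
  it are unconstrained and irrelevant.
\<close>

record ('w, 'p) model =
  worlds :: "'w set"
  below :: "'w \<Rightarrow> 'w \<Rightarrow> bool"
  succ :: "'w \<Rightarrow> 'w"
  val :: "'w \<Rightarrow> 'p set"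

definition is_model :: "('w, 'p) model \<Rightarrow> bool" where
  "is_model M \<longleftrightarrow>
     worlds M \<noteq> {} \<and>
     reflp_on (worlds M) (below M) \<and>
     transp_on (worlds M) (below M) \<and>
     antisymp_on (worlds M) (below M) \<and>
     (\<forall>w \<in> worlds M. succ M w \<in> worlds M) \<and>
     (\<forall>w \<in> worlds M. \<forall>v \<in> worlds M. below M w v \<longrightarrow> below M (succ M w) (succ M v)) \<and>
     (\<forall>w \<in> worlds M. \<forall>v \<in> worlds M. below M w v \<longrightarrow> val M w \<subseteq> val M v)"

primrec sat :: "('w, 'p) model \<Rightarrow> 'w \<Rightarrow> 'p fm \<Rightarrow> bool" where
  "sat M w (Var p) \<longleftrightarrow> p \<in> val M w"
| "sat M w Bot \<longleftrightarrow> False"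
| "sat M w (And \<phi> \<psi>) \<longleftrightarrow> sat M w \<phi> \<and> sat M w \<psi>"
| "sat M w (Or \<phi> \<psi>) \<longleftrightarrow> sat M w \<phi> \<or> sat M w \<psi>"
| "sat M w (Imp \<phi> \<psi>) \<longleftrightarrow>
     (\<forall>v \<in> worlds M. below M w v \<longrightarrow> sat M v \<phi> \<longrightarrow> sat M v \<psi>)"
| "sat M w (Next \<phi>) \<longleftrightarrow> sat M (succ M w) \<phi>"
| "sat M w (Box \<phi>) \<longleftrightarrow> (\<forall>k. sat M ((succ M ^^ k) w) \<phi>)"
| "sat M w (Until \<phi> \<psi>) \<longleftrightarrow>
     (\<exists>k. sat M ((succ M ^^ k) w) \<psi> \<and> (\<forall>i<k. sat M ((succ M ^^ i) w) \<phi>))"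

definition valid_over :: "('w, 'p) model set \<Rightarrow> 'p fm \<Rightarrow> bool" where
  "valid_over C \<phi> \<longleftrightarrow> (\<forall>M \<in> C. \<forall>w \<in> worlds M. sat M w \<phi>)"

definition here_and_there :: "('t \<times> nat, 'p) model \<Rightarrow> bool" where
  "here_and_there M \<longleftrightarrow>
     is_model M \<and>
     (\<exists>T. worlds M = T \<times> {0, 1} \<and>
       (\<exists>f. (\<forall>t \<in> T. f t \<in> T) \<and>
         (\<forall>t \<in> T. \<forall>s \<in> T. \<forall>i \<in> {0, 1}. \<forall>j \<in> {0, 1}.
            below M (t, i) (s, j) \<longleftrightarrow> t = s \<and> i \<le> j) \<and>
         (\<forall>t \<in> T. \<forall>i \<in> {0, 1}. succ M (t, i) = (f t, i))))"

text \<open>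
  The set \<open>T\<close> is taken among the sets of natural numbers. This loses no finite model up to
  isomorphism, whereas a type variable in its place could be instantiated by a finite type,
  which would bound the size of the models.
\<close>

definition finite_here_and_there_models :: "(nat \<times> nat, 'p) model set" where
  "finite_here_and_there_models = {M. here_and_there M \<and> finite (worlds M)}"

end

theory Submission
  imports Defs
begin

text \<open>
  If \<open>p\<close> holds throughout the upper (``there'') layer, no formula can distinguish the
  points of that layer, so an until-formula true there has its right argument true there
  everywhere. Consequently a formula without \<open>\<box>\<close> that is true in the upper layer is
  already true at every lower point from which \<open>p\<close> persists for as many steps as the nesting
  depth of \<open>\<circle>\<close>: an until-formula is then witnessed at step \<open>0\<close>. So if \<open>\<phi>\<close> were equivalent to
  \<open>\<box>p\<close>, it would hold at a lower point where \<open>p\<close> fails only later than \<open>\<phi>\<close> can look.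
\<close>

lemma succ_funpow_in_worlds:
  assumes "is_model M" "w \<in> worlds M"
  shows "(succ M ^^ k) w \<in> worlds M"
  using assms by (induction k) (auto simp: is_model_def)

lemma below_succ_funpow:
  assumes "is_model M" "w \<in> worlds M" "v \<in> worlds M" "below M w v"
  shows "below M ((succ M ^^ k) w) ((succ M ^^ k) v)"
proof (induction k)
  case (Suc k)
  then show ?case
    using assms succ_funpow_in_worlds[OF assms(1), of _ k] by (simp add: is_model_def)
qed (use assms in simp)

text \<open>Transitivity settles implication. Forward confluence, iterated along orbits, settles the
  temporal operators: the same step numbers serve as witnesses above.\<close>

lemma sat_persistent:
  assumes "is_model M" "w \<in> worlds M" "v \<in> worlds M" "below M w v" "sat M w \<phi>"
  shows "sat M v \<phi>"
  using assms(2-)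
proof (induction \<phi> arbitrary: w v)
  case (Var q)
  moreover have "val M w \<subseteq> val M v"
    using Var.prems assms(1) by (simp add: is_model_def)
  ultimately show ?case by auto
next
  case (Imp \<phi> \<psi>)
  have "transp_on (worlds M) (below M)"
    using assms(1) by (simp add: is_model_def)
  then have "below M w u" if "u \<in> worlds M" "below M v u" for u
    using Imp.prems that by (auto dest: transp_onD)
  then show ?case using Imp.prems by simp
next
  case (Next \<phi>)
  have "sat M (succ M v) \<phi>"
    by (rule Next.IH[of "succ M w"]) (use Next.prems assms(1) in \<open>auto simp: is_model_def\<close>)
  then show ?case by simp
next
  case (Box \<phi>)
  have "sat M ((succ M ^^ k) v) \<phi>" for k
    by (rule Box.IH[OF _ _ below_succ_funpow[OF assms(1)]])
      (use Box.prems in \<open>auto intro: succ_funpow_in_worlds[OF assms(1)]\<close>)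
  then show ?case by simp
next
  case (Until \<phi> \<psi>)
  note orbit = succ_funpow_in_worlds[OF assms(1)] below_succ_funpow[OF assms(1) Until.prems(1-3)]
  obtain k where "sat M ((succ M ^^ k) w) \<psi>" "\<forall>i<k. sat M ((succ M ^^ i) w) \<phi>"
    using Until.prems(4) by auto
  then have "sat M ((succ M ^^ k) v) \<psi>" "\<forall>i<k. sat M ((succ M ^^ i) v) \<phi>"
    using Until.IH(1)[OF orbit(1) orbit(1) orbit(2)] Until.IH(2)[OF orbit(1) orbit(1) orbit(2)]
      Until.prems(1,2) by blast+
  then show ?case by auto
qed auto

text \<open>A path 0, ..., \<open>n\<close> ending in a fixed point. The lower copy of
  \<open>n\<close> is the only world without \<open>p\<close>, so a lower point \<open>t\<close>
  meets the failure after exactly \<open>n - t\<close> steps.\<close>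

definition delay_model :: "'p \<Rightarrow> nat \<Rightarrow> (nat \<times> nat, 'p) model" where
  "delay_model p n =
    \<lparr>worlds = {..n} \<times> {0, 1},
     below = (\<lambda>w v. fst w = fst v \<and> snd w \<le> snd v),
     succ = (\<lambda>w. (min (Suc (fst w)) n, snd w)),
     val = (\<lambda>w. if fst w < n \<or> snd w = 1 then {p} else {})\<rparr>"

lemma delay_model_sel [simp]:
  "worlds (delay_model p n) = {..n} \<times> {0, 1}"
  "below (delay_model p n) w v \<longleftrightarrow> fst w = fst v \<and> snd w \<le> snd v"
  "succ (delay_model p n) w = (min (Suc (fst w)) n, snd w)"
  "val (delay_model p n) w = (if fst w < n \<or> snd w = 1 then {p} else {})"
  by (simp_all add: delay_model_def)

lemma is_model_delay_model: "is_model (delay_model p n)"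
  by (auto simp: is_model_def reflp_on_def transp_on_def antisymp_on_def)

lemma delay_model_in_finite_here_and_there_models:
  "delay_model p n \<in> finite_here_and_there_models"
proof -
  have "here_and_there (delay_model p n)"
    unfolding here_and_there_def
    by (intro conjI is_model_delay_model exI[of _ "{..n}"] exI[of _ "\<lambda>t. min (Suc t) n"]) auto
  then show ?thesis by (simp add: finite_here_and_there_models_def)
qed

lemma succ_funpow_delay_model:
  "t \<le> n \<Longrightarrow> (succ (delay_model p n) ^^ k) (t, i) = (min (t + k) n, i)"
  by (induction k) auto

text \<open>Upper points are maximal and share one valuation. Implication is therefore classical
  there, and the temporal operators never leave the layer.\<close>

lemma sat_delay_model_there_const:
  assumes "t \<le> n" "s \<le> n"
  shows "sat (delay_model p n) (t, 1) \<phi> \<longleftrightarrow> sat (delay_model p n) (s, 1) \<phi>"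
  using assms
proof (induction \<phi> arbitrary: t s)
  case (And \<phi> \<psi>)
  then show ?case unfolding sat.simps by blast
next
  case (Or \<phi> \<psi>)
  then show ?case unfolding sat.simps by blast
next
  case (Imp \<phi> \<psi>)
  have "sat (delay_model p n) (u, 1) (Imp \<phi> \<psi>) \<longleftrightarrow>
      (sat (delay_model p n) (u, 1) \<phi> \<longrightarrow> sat (delay_model p n) (u, 1) \<psi>)" if "u \<le> n" for u
    using that by (auto simp: le_Suc_eq)
  then show ?case using Imp by metis
next
  case (Next \<phi>)
  show ?case using Next.IH[of "min (Suc t) n" "min (Suc s) n"] by simp
next
  case (Box \<phi>)
  have "sat (delay_model p n) (min (t + k) n, 1) \<phi> \<longleftrightarrow>
      sat (delay_model p n) (min (s + k) n, 1) \<phi>" for k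
    by (rule Box.IH) simp_all
  then show ?case using Box.prems by (simp add: succ_funpow_delay_model)
next
  case (Until \<phi> \<psi>)
  have "sat (delay_model p n) (min (t + k) n, 1) \<phi> \<longleftrightarrow>
      sat (delay_model p n) (min (s + k) n, 1) \<phi>"
    "sat (delay_model p n) (min (t + k) n, 1) \<psi> \<longleftrightarrow>
      sat (delay_model p n) (min (s + k) n, 1) \<psi>" for k
    by (rule Until.IH; simp)+
  then show ?case using Until.prems by (simp add: succ_funpow_delay_model)
qed simp_all

text \<open>\<open>Until\<close> does not raise the depth, since its witness will be found at step
  0; only \<open>Next\<close> forces a move along the path.\<close>

primrec next_depth :: "'p fm \<Rightarrow> nat" where
  "next_depth (Var q) = 0"
| "next_depth Bot = 0"
| "next_depth (And \<phi> \<psi>) = max (next_depth \<phi>) (next_depth \<psi>)"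
| "next_depth (Or \<phi> \<psi>) = max (next_depth \<phi>) (next_depth \<psi>)"
| "next_depth (Imp \<phi> \<psi>) = max (next_depth \<phi>) (next_depth \<psi>)"
| "next_depth (Next \<phi>) = Suc (next_depth \<phi>)"
| "next_depth (Box \<phi>) = next_depth \<phi>"
| "next_depth (Until \<phi> \<psi>) = max (next_depth \<phi>) (next_depth \<psi>)"

text \<open>The strict bound keeps every point reached by nested \<open>Next\<close> before
  \<open>n\<close>, where \<open>p\<close> still holds in the lower layer.\<close>

lemma sat_delay_model_here:
  assumes "\<phi> \<in> L_U" "t + next_depth \<phi> < n" "sat (delay_model p n) (t, 1) \<phi>"
  shows "sat (delay_model p n) (t, 0) \<phi>"
  using assms
proof (induction \<phi> arbitrary: t)
  case (5 \<phi> \<psi>)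
  have there: "sat (delay_model p n) (t, 1) \<phi> \<longrightarrow> sat (delay_model p n) (t, 1) \<psi>"
    using "5.prems" by simp
  \<comment> \<open>Persistence lifts the antecedent to the upper point, \<open>there\<close> yields
    the consequent there, and the induction hypothesis brings it back down.\<close>
  have "sat (delay_model p n) (t, 1) \<phi>" if "sat (delay_model p n) (t, 0) \<phi>"
    using sat_persistent[OF is_model_delay_model _ _ _ that] "5.prems"(1) by simp
  then show ?case using 5 there by auto
next
  case (7 \<phi> \<psi>)
  \<comment> \<open>The step \<open>k\<close> may lie beyond the reach of the bound; constancy of
    the upper layer moves the witness back to \<open>t\<close> itself.\<close>
  then obtain k where "sat (delay_model p n) (min (t + k) n, 1) \<psi>"
    by (auto simp: succ_funpow_delay_model)
  then have "sat (delay_model p n) (t, 1) \<psi>"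
    using sat_delay_model_there_const[of t n "min (t + k) n" p \<psi>] "7.prems"(1) by simp
  then have "sat (delay_model p n) (t, 0) \<psi>" using 7 by auto
  then show ?case by (auto intro!: exI[of _ 0])
qed auto

theorem theorem8p1:
  fixes p :: 'p
  shows "\<not> (\<exists>\<phi> \<in> L_U. valid_over finite_here_and_there_models (Iff (Box (Var p)) \<phi>))"
proof
  assume "\<exists>\<phi> \<in> L_U. valid_over finite_here_and_there_models (Iff (Box (Var p)) \<phi>)"
  then obtain \<phi> where \<phi>: "\<phi> \<in> L_U"
    and valid: "valid_over finite_here_and_there_models (Iff (Box (Var p)) \<phi>)" by blast
  \<comment> \<open>The least length admitting \<open>sat_delay_model_here\<close> at the start 0 of
    the path.\<close>
  define n where "n = Suc (next_depth \<phi>)"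
  let ?M = "delay_model p n"
  have equiv: "sat ?M (0, i) (Box (Var p)) \<longleftrightarrow> sat ?M (0, i) \<phi>" if "i \<in> {0, 1}" for i
  proof -
    have world: "(0, i) \<in> worlds ?M" using that by simp
    then have "sat ?M (0, i) (Iff (Box (Var p)) \<phi>)"
      using valid delay_model_in_finite_here_and_there_models[of p n]
      by (auto simp only: valid_over_def)
    moreover have "below ?M (0, i) (0, i)" by simp
    ultimately show ?thesis
      using world unfolding Iff_def sat.simps(3,5) by blast
  qed
  have "sat ?M (0, 1) (Box (Var p))"
    by (simp add: succ_funpow_delay_model del: One_nat_def)
  then have "sat ?M (0, 1) \<phi>" using equiv by blast
  then have "sat ?M (0, 0) \<phi>" using sat_delay_model_here[OF \<phi>, of 0 n] by (simp add: n_def)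
  then have "sat ?M (0, 0) (Box (Var p))" using equiv by blast
  then have "sat ?M ((succ ?M ^^ n) (0, 0)) (Var p)" unfolding sat.simps(7) by blast
  then show False by (simp add: succ_funpow_delay_model)
qed

end
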